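(* Censorship of coherence $(\mathcal{F},\mathcal{O}_{\mathrm{IO}})$ is secure. That is: let $N\ge1$, $\epsilon\in[0,1)$, and $\Omega(\rho)=\epsilon\rho+(1-\epsilon)\Delta(\rho)$ on $\mathbb{C}^d$ with $\Delta(\rho)=\sum_a|a\rangle\langle a|\rho|a\rangle\langle a|$. For every state $\rho\notin\mathcal{F}(A_1\dots A_N)$ there is no incoherent operation $\Lambda\in\mathcal{O}_{\mathrm{IO}}(B_1\dots B_N)$ such that $\Lambda(\Omega^{\otimes N}(\rho))=\rho$.
   Context: Resource theory of coherence on $N$ systems: each sender system $A_i$ and receiver system $B_i$ has Hilbert space $\mathbb{C}^d$ with fixed incoherent orthonormal basis $\{|a\rangle\}_{a=0}^{d-1}$ (the systems $A_i$ and $B_i$ are identified). $\mathcal{F}(A_1\dots A_N)$ is the set of density operators diagonal in the product basis, $\sum_{a_1,\dots,a_N}p_{a_1\dots a_N}|a_1\dots a_N\rangle\langle a_1\dots a_N|$ with $p$ a probability distribution. $\mathcal{O}_{\mathrm{IO}}(B_1\dots B_N)$ is the set of channels $\Lambda(\rho)=\sum_aM_a\rho M_a^\dagger$, $\sum_aM_a^\dagger M_a=\mathbb{1}$, with $M_a=\sum_{b}c_{ab}|f_a(b)\rangle\langle b|$, where $b=(b_1,\dots,b_N)$ runs over $\{0,\dots,d-1\}^{N}$, $|b\rangle=|b_1\dots b_N\rangle$, $c_{ab}\in\mathbb{C}$, and $f_a:\{0,\dots,d-1\}^N\to\{0,\dots,d-1\}^N$. Censorship is secure if for every state $\rho\notin\mathcal{F}(A_1\dots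 A_N)$ the censored state $\Omega^{\otimes N}(\rho)$ cannot be converted to $\rho$ by a free operation in $\mathcal{O}_{\mathrm{IO}}(B_1\dots B_N)$. *)

theory Defs
  imports "HOL-Analysis.Analysis"
begin

text \<open>Operators on \<open>\<complex>\<^sup>I\<close> are matrices over a finite index type of basis labels. A single
  system has label type \<open>'d\<close>, so \<open>d = CARD('d) \<ge> 1\<close>. The composite of the systems indexed by \<open>'n\<close>,
  where \<open>N = CARD('n) \<ge> 1\<close>, has label type \<open>'n \<Rightarrow> 'd\<close>: the label \<open>a\<close> stands for the product
  basis vector \<open>|a\<^sub>1 \<dots> a\<^sub>N\<rangle>\<close>.\<close>

type_synonym 'i op = "complex ^ 'i ^ 'i"

definition dagger :: "'i::finite op \<Rightarrow> 'i op" where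
  "dagger A = (\<chi> i j. cnj (A $ j $ i))"

definition cscale :: "complex \<Rightarrow> 'i::finite op \<Rightarrow> 'i op" where
  "cscale c A = (\<chi> i j. c * A $ i $ j)"

text \<open>The operator \<open>|a\<rangle>\<langle>b|\<close>.\<close>

definition ketbra :: "'i::finite \<Rightarrow> 'i \<Rightarrow> 'i op" where
  "ketbra a b = (\<chi> i j. if i = a \<and> j = b then 1 else 0)"

definition positive_op :: "'i::finite op \<Rightarrow> bool" where
  "positive_op A \<longleftrightarrow> dagger A = A \<and> (\<forall>v. 0 \<le> Re (\<Sum>i\<in>UNIV. cnj (v $ i) * (A *v v) $ i))"

definition density_operator :: "'i::finite op \<Rightarrow> bool" where
  "density_operator \<rho> \<longleftrightarrow> positive_op \<rho> \<and> trace \<rho> = 1"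

definition incoherent_states :: "'i::finite op set" where
  "incoherent_states =
     {\<rho>. \<exists>p :: 'i \<Rightarrow> real. (\<forall>a. 0 \<le> p a) \<and> (\<Sum>a\<in>UNIV. p a) = 1
           \<and> \<rho> = (\<Sum>a\<in>UNIV. p a *\<^sub>R ketbra a a)}"

definition incoherent_kraus :: "'i::finite op \<Rightarrow> bool" where
  "incoherent_kraus M \<longleftrightarrow>
     (\<exists>(c :: 'i \<Rightarrow> complex) (f :: 'i \<Rightarrow> 'i). M = (\<Sum>b\<in>UNIV. cscale (c b) (ketbra (f b) b)))"

definition incoherent_operations :: "('i::finite op \<Rightarrow> 'i op) set" where
  "incoherent_operations =
     {\<Lambda>. \<exists>(m :: nat) (M :: nat \<Rightarrow> 'i op).
            (\<forall>k<m. incoherent_kraus (M k))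
          \<and> (\<Sum>k<m. dagger (M k) ** M k) = mat 1
          \<and> \<Lambda> = (\<lambda>\<rho>. \<Sum>k<m. M k ** \<rho> ** dagger (M k))}"

definition dephasing :: "'d::finite op \<Rightarrow> 'd op" where
  "dephasing \<rho> = (\<Sum>a\<in>UNIV. ketbra a a ** \<rho> ** ketbra a a)"

definition censor :: "real \<Rightarrow> 'd::finite op \<Rightarrow> 'd op" where
  "censor \<epsilon> \<rho> = \<epsilon> *\<^sub>R \<rho> + (1 - \<epsilon>) *\<^sub>R dephasing \<rho>"

definition tensor_op :: "('n::finite \<Rightarrow> 'd::finite op) \<Rightarrow> ('n \<Rightarrow> 'd) op" where
  "tensor_op A = (\<chi> x y. \<Prod>i\<in>UNIV. A i $ x i $ y i)"

text \<open>For linear \<open>E\<close>, the linear extension of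
  \<open>|a\<rangle>\<langle>b| = \<Otimes>\<^sub>i |a\<^sub>i\<rangle>\<langle>b\<^sub>i| \<mapsto> \<Otimes>\<^sub>i E(|a\<^sub>i\<rangle>\<langle>b\<^sub>i|)\<close>; see
  \<open>tensor_op_ketbra\<close> and \<open>tensor_power_tensor_op\<close> below.\<close>

definition tensor_power :: "('d::finite op \<Rightarrow> 'd op) \<Rightarrow> ('n::finite \<Rightarrow> 'd) op \<Rightarrow> ('n \<Rightarrow> 'd) op" where
  "tensor_power E \<rho> =
     (\<Sum>a\<in>UNIV. \<Sum>b\<in>UNIV. cscale (\<rho> $ a $ b) (tensor_op (\<lambda>i. E (ketbra (a i) (b i)))))"

lemma tensor_op_ketbra: "tensor_op (\<lambda>i. ketbra (a i) (b i)) = ketbra a b"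
proof -
  have "(\<Prod>i\<in>UNIV. if x i = a i \<and> y i = b i then 1 else 0)
      = (if x = a \<and> y = b then 1 else (0::complex))" for x y :: "'a \<Rightarrow> 'b"
    by (auto simp: fun_eq_iff)
  then show ?thesis
    by (simp add: tensor_op_def ketbra_def vec_eq_iff)
qed

lemma prod_sum_UNIV:
  fixes g :: "'n::finite \<Rightarrow> 'd::finite \<Rightarrow> complex"
  shows "(\<Prod>i\<in>UNIV. \<Sum>s\<in>UNIV. g i s) = (\<Sum>a\<in>UNIV. \<Prod>i\<in>UNIV. g i (a i))"
  using prod_sum_PiE[of UNIV "\<lambda>_. UNIV" g] by (simp add: PiE_UNIV_domain)

lemma tensor_power_tensor_op:
  fixes E :: "'d::finite op \<Rightarrow> 'd op" and A :: "'n::finite \<Rightarrow> 'd op"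
  assumes E_add: "\<And>X Y. E (X + Y) = E X + E Y"
    and E_scale: "\<And>c X. E (cscale c X) = cscale c (E X)"
  shows "tensor_power E (tensor_op A) = tensor_op (\<lambda>i. E (A i))"
proof -
  have E_zero: "E 0 = 0"
    using E_add[of 0 0] by simp
  have E_sum: "E (\<Sum>s\<in>S. h s) = (\<Sum>s\<in>S. E (h s))" if "finite S" for h :: "'d \<Rightarrow> 'd op" and S
    using that by induction (simp_all add: E_zero E_add)
  have decomp: "X = (\<Sum>s\<in>UNIV. \<Sum>t\<in>UNIV. cscale (X $ s $ t) (ketbra s t))" for X :: "'d op"
  proof -
    have "(\<Sum>t\<in>UNIV. X $ s $ t * (if i = s \<and> j = t then 1 else 0)) = (if i = s then X $ s $ j else 0)"
      for i j s
      by (cases "i = s") (simp_all add: if_distrib cong: if_cong)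
    then show ?thesis
      by (simp add: vec_eq_iff cscale_def ketbra_def)
  qed
  have E_entry: "E X $ u $ v = (\<Sum>s\<in>UNIV. \<Sum>t\<in>UNIV. X $ s $ t * E (ketbra s t) $ u $ v)" for X u v
    by (subst decomp) (simp add: E_sum E_scale, simp add: cscale_def)
  show ?thesis
    by (simp add: vec_eq_iff tensor_power_def tensor_op_def E_entry[of "A _"] prod_sum_UNIV
        cscale_def prod.distrib)
qed

end

theory Submission
  imports Defs
begin

text \<open>The \<open>l\<^sub>1\<close>-norm of coherence, the sum of the absolute values of the off-diagonal entries,
  does not increase under incoherent operations (Baumgratz, Cramer, Plenio). The censorship
  \<open>\<Omega>\<^sup>\<otimes>\<^sup>N\<close> multiplies the entry at \<open>(x, y)\<close> by \<open>\<epsilon>\<close> to the Hamming distance of \<open>x\<close> and \<open>y\<close>, hence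
  shrinks the \<open>l\<^sub>1\<close>-norm by at least the factor \<open>\<epsilon> < 1\<close>. If a state can be recovered, its norm of
  coherence is therefore \<open>0\<close>, so it is diagonal.\<close>

definition l1_coherence :: "'i::finite op \<Rightarrow> real" where
  "l1_coherence A = (\<Sum>x\<in>UNIV. \<Sum>y\<in>UNIV. if x = y then 0 else cmod (A $ x $ y))"

lemma l1_coherence_triangle:
  "l1_coherence (\<Sum>k\<in>S. A k) \<le> (\<Sum>k\<in>S. l1_coherence (A k))"
proof -
  have "l1_coherence (\<Sum>k\<in>S. A k)
      \<le> (\<Sum>x\<in>UNIV. \<Sum>y\<in>UNIV. \<Sum>k\<in>S. if x = y then 0 else cmod (A k $ x $ y))"
    unfolding l1_coherence_def by (intro sum_mono) (simp add: norm_sum)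
  also have "\<dots> = (\<Sum>x\<in>UNIV. \<Sum>k\<in>S. \<Sum>y\<in>UNIV. if x = y then 0 else cmod (A k $ x $ y))"
    by (intro sum.cong refl sum.swap)
  also have "\<dots> = (\<Sum>k\<in>S. l1_coherence (A k))"
    unfolding l1_coherence_def by (rule sum.swap)
  finally show ?thesis .
qed

section \<open>Monotonicity of the coherence norm under incoherent operations\<close>

lemma incoherent_kraus_nth:
  assumes "incoherent_kraus M"
  obtains c f where "\<And>i b. M $ i $ b = (if i = f b then c b else 0)"
proof -
  obtain c f where M: "M = (\<Sum>b\<in>UNIV. cscale (c b) (ketbra (f b) b))"
    using assms by (auto simp: incoherent_kraus_def)
  have "M $ i $ b = (if i = f b then c b else 0)" for i b
  proof -
    have "M $ i $ b = (\<Sum>b'\<in>UNIV. if b = b' then (if i = f b then c b else 0) else 0)"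
      unfolding M sum_component by (intro sum.cong refl) (auto simp: cscale_def ketbra_def)
    then show ?thesis by simp
  qed
  then show ?thesis using that by blast
qed

lemma sandwich_nth:
  "(M ** A ** dagger M) $ i $ j
     = (\<Sum>l\<in>UNIV. \<Sum>k\<in>UNIV. M $ i $ k * A $ k $ l * cnj (M $ j $ l))"
  by (simp add: matrix_matrix_mult_def dagger_def sum_distrib_right)

text \<open>Links squared column norms to the quantities that the completeness relation sums to 1
  over all Kraus operators.\<close>

lemma dagger_mult_self_diag:
  "Re ((dagger M ** M) $ b $ b) = (\<Sum>i\<in>UNIV. (cmod (M $ i $ b))\<^sup>2)"
proof -
  have "(dagger M ** M) $ b $ b = (\<Sum>i\<in>UNIV. of_real ((cmod (M $ i $ b))\<^sup>2))"
    unfolding matrix_matrix_mult_def dagger_def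
    by (simp add: complex_norm_square mult.commute del: of_real_power)
  then show ?thesis by (simp add: Re_sum del: of_real_power)
qed

text \<open>All nonzero contributions of the entry \<open>A\<^sub>k\<^sub>l\<close> to \<open>M A M\<^sup>\<dagger>\<close> sit at the single position
  \<open>(f k, f l)\<close>; in particular diagonal entries of \<open>A\<close> contribute nothing off the diagonal.\<close>

lemma l1_coherence_incoherent_kraus:
  assumes "incoherent_kraus M"
  shows "l1_coherence (M ** A ** dagger M)
    \<le> (\<Sum>l\<in>UNIV. \<Sum>k\<in>UNIV. if k = l then 0 else
         cmod (A $ k $ l) *
           (Re ((dagger M ** M) $ k $ k) + Re ((dagger M ** M) $ l $ l)) / 2)"
proof -
  obtain c f where M: "\<And>i b. M $ i $ b = (if i = f b then c b else 0)"
    using incoherent_kraus_nth[OF assms] by blast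
  have diag: "Re ((dagger M ** M) $ b $ b) = (cmod (c b))\<^sup>2" for b
  proof -
    have "(\<Sum>i\<in>UNIV. (cmod (M $ i $ b))\<^sup>2) = (\<Sum>i\<in>UNIV. if i = f b then (cmod (c b))\<^sup>2 else 0)"
      by (intro sum.cong) (auto simp: M)
    then show ?thesis by (simp add: dagger_mult_self_diag)
  qed
  \<comment> \<open>Triangle-inequality bound on what the input entry \<open>(k, l)\<close>
    contributes to the output entry \<open>(i, j)\<close>, with diagonal outputs removed.\<close>
  define g where "g i j l k =
    (if i = j then 0 else cmod (M $ i $ k) * cmod (A $ k $ l) * cmod (M $ j $ l))" for i j l k
  have "l1_coherence (M ** A ** dagger M)
      \<le> (\<Sum>i\<in>UNIV. \<Sum>j\<in>UNIV. \<Sum>l\<in>UNIV. \<Sum>k\<in>UNIV. g i j l k)"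
    unfolding l1_coherence_def sandwich_nth g_def
    by (intro sum_mono) (auto intro!: sum_norm_le simp: norm_mult)
  \<comment> \<open>The swaps move the output indices \<open>i\<close>, \<open>j\<close> innermost,
    so that each input position \<open>(k, l)\<close> can be treated separately.\<close>
  also have "\<dots> = (\<Sum>i\<in>UNIV. \<Sum>l\<in>UNIV. \<Sum>j\<in>UNIV. \<Sum>k\<in>UNIV. g i j l k)"
    by (intro sum.cong refl sum.swap)
  also have "\<dots> = (\<Sum>i\<in>UNIV. \<Sum>l\<in>UNIV. \<Sum>k\<in>UNIV. \<Sum>j\<in>UNIV. g i j l k)"
    by (intro sum.cong refl sum.swap)
  also have "\<dots> = (\<Sum>l\<in>UNIV. \<Sum>i\<in>UNIV. \<Sum>k\<in>UNIV. \<Sum>j\<in>UNIV. g i j l k)"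
    by (rule sum.swap)
  also have "\<dots> = (\<Sum>l\<in>UNIV. \<Sum>k\<in>UNIV. \<Sum>i\<in>UNIV. \<Sum>j\<in>UNIV. g i j l k)"
    by (intro sum.cong refl sum.swap)
  also have "\<dots> \<le> (\<Sum>l\<in>UNIV. \<Sum>k\<in>UNIV. if k = l then 0 else
         cmod (A $ k $ l) *
           (Re ((dagger M ** M) $ k $ k) + Re ((dagger M ** M) $ l $ l)) / 2)"
  proof (intro sum_mono)
    fix l k
    have g: "g i j l k = (if j = f l then if i = f k then if f k = f l then 0
        else cmod (c k) * cmod (A $ k $ l) * cmod (c l) else 0 else 0)" for i j
      by (auto simp: g_def M)
    have "(\<Sum>i\<in>UNIV. \<Sum>j\<in>UNIV. g i j l k)
        = (if f k = f l then 0 else cmod (c k) * cmod (A $ k $ l) * cmod (c l))"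
      by (simp add: g)
    \<comment> \<open>Since \<open>k = l\<close> forces \<open>f k = f l\<close>, the only loss is
      at distinct \<open>k\<close>, \<open>l\<close> with \<open>f k = f l\<close>, where the entry
      lands on the diagonal.\<close>
    also have "\<dots> \<le> (if k = l then 0 else cmod (A $ k $ l) * (cmod (c k) * cmod (c l)))"
      by (auto simp: mult_ac)
    also have "\<dots> \<le> (if k = l then 0 else
        cmod (A $ k $ l) * (((cmod (c k))\<^sup>2 + (cmod (c l))\<^sup>2) / 2))"
    \<comment> \<open>The arithmetic-geometric mean inequality gives a bound linear in the diagonal
      of \<open>dagger M ** M\<close>, which can later be summed over the Kraus operators.\<close>
    proof -
      have "cmod (c k) * cmod (c l) \<le> ((cmod (c k))\<^sup>2 + (cmod (c l))\<^sup>2) / 2"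
        using sum_squares_bound[of "cmod (c k)" "cmod (c l)"] by simp
      then have "cmod (A $ k $ l) * (cmod (c k) * cmod (c l))
          \<le> cmod (A $ k $ l) * (((cmod (c k))\<^sup>2 + (cmod (c l))\<^sup>2) / 2)"
        by (rule mult_left_mono) simp
      then show ?thesis by simp
    qed
    finally show "(\<Sum>i\<in>UNIV. \<Sum>j\<in>UNIV. g i j l k) \<le> (if k = l then 0 else
         cmod (A $ k $ l) *
           (Re ((dagger M ** M) $ k $ k) + Re ((dagger M ** M) $ l $ l)) / 2)"
      by (simp only: diag times_divide_eq_right)
  qed
  finally show ?thesis .
qed

text \<open>Summed over the Kraus operators, the weights attached to each off-diagonal entry total
  \<open>(1 + 1) / 2 = 1\<close> by completeness.\<close>

lemma l1_coherence_incoherent_operation: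
  assumes "\<Lambda> \<in> incoherent_operations"
  shows "l1_coherence (\<Lambda> A) \<le> l1_coherence A"
proof -
  obtain m :: nat and M where inc: "\<And>n. n < m \<Longrightarrow> incoherent_kraus (M n)"
    and id: "(\<Sum>n<m. dagger (M n) ** M n) = mat (1::complex)"
    and \<Lambda>: "\<Lambda> = (\<lambda>\<rho>. \<Sum>n<m. M n ** \<rho> ** dagger (M n))"
    using assms by (auto simp: incoherent_operations_def)
  \<comment> \<open>This is the probability of outcome \<open>n\<close> on the basis state
    \<open>b\<close>.\<close>
  define r where "r n b = Re ((dagger (M n) ** M n) $ b $ b)" for n b
  have r: "(\<Sum>n<m. r n b) = 1" for b
  proof -
    have "(\<Sum>n<m. r n b) = Re ((\<Sum>n<m. dagger (M n) ** M n) $ b $ b)"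
      by (simp add: r_def)
    then show ?thesis by (simp add: id mat_def)
  qed
  define h where "h n l k =
    (if k = l then 0 else cmod (A $ k $ l) * (r n k + r n l) / 2)" for n l k
  have "l1_coherence (\<Lambda> A) \<le> (\<Sum>n<m. l1_coherence (M n ** A ** dagger (M n)))"
    unfolding \<Lambda> by (rule l1_coherence_triangle)
  also have "\<dots> \<le> (\<Sum>n<m. \<Sum>l\<in>UNIV. \<Sum>k\<in>UNIV. h n l k)"
    unfolding h_def r_def by (intro sum_mono l1_coherence_incoherent_kraus) (simp add: inc)
  also have "\<dots> = (\<Sum>l\<in>UNIV. \<Sum>n<m. \<Sum>k\<in>UNIV. h n l k)"
    by (rule sum.swap)
  also have "\<dots> = (\<Sum>l\<in>UNIV. \<Sum>k\<in>UNIV. \<Sum>n<m. h n l k)"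
    by (intro sum.cong refl sum.swap)
  also have "\<dots> = (\<Sum>l\<in>UNIV. \<Sum>k\<in>UNIV. if k = l then 0 else cmod (A $ k $ l))"
  proof (intro sum.cong refl)
    fix l k
    have "(\<Sum>n<m. cmod (A $ k $ l) * (r n k + r n l) / 2)
        = cmod (A $ k $ l) * ((\<Sum>n<m. r n k) + (\<Sum>n<m. r n l)) / 2"
      by (simp only: sum_divide_distrib[symmetric] sum_distrib_left[symmetric] sum.distrib)
    then show "(\<Sum>n<m. h n l k) = (if k = l then 0 else cmod (A $ k $ l))"
      by (simp add: h_def r)
  qed
  also have "\<dots> = l1_coherence A"
    unfolding l1_coherence_def by (rule sum.swap)
  finally show ?thesis .
qed

section \<open>Entrywise action of the censorship\<close>

lemma dephasing_nth: "dephasing A $ s $ t = (if s = t then A $ s $ t else 0)"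
proof -
  have "(ketbra a a ** A ** ketbra a a) $ s $ t
      = (if a = s then if s = t then A $ s $ t else 0 else 0)" for a
  proof -
    have "(ketbra a a ** A) $ s $ u = (if s = a then A $ a $ u else 0)" for u
    proof -
      have "(ketbra a a ** A) $ s $ u
          = (\<Sum>k\<in>UNIV. if k = a then (if s = a then A $ a $ u else 0) else 0)"
        unfolding matrix_matrix_mult_def vec_lambda_beta
        by (intro sum.cong refl) (auto simp: ketbra_def)
      then show ?thesis by simp
    qed
    moreover have "(B ** ketbra a a) $ s $ t = (if t = a then B $ s $ a else 0)"
      for B :: "'a op"
    proof -
      have "(B ** ketbra a a) $ s $ t
          = (\<Sum>k\<in>UNIV. if k = a then (if t = a then B $ s $ a else 0) else 0)"
        unfolding matrix_matrix_mult_def vec_lambda_beta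
        by (intro sum.cong refl) (auto simp: ketbra_def)
      then show ?thesis by simp
    qed
    ultimately show ?thesis by auto
  qed
  then show ?thesis by (simp add: dephasing_def)
qed

lemma censor_nth:
  "censor \<epsilon> A $ s $ t = (if s = t then 1 else of_real \<epsilon>) * A $ s $ t"
  by (simp add: censor_def dephasing_nth scaleR_conv_of_real[where 'a = complex] algebra_simps)

lemma tensor_power_censor_nth:
  fixes \<rho> :: "('n::finite \<Rightarrow> 'd::finite) op"
  shows "tensor_power (censor \<epsilon>) \<rho> $ x $ y
    = (\<Prod>i\<in>UNIV. if x i = y i then 1 else of_real \<epsilon>) * \<rho> $ x $ y"
proof -
  define w where "w = (\<Prod>i\<in>UNIV. if x i = y i then 1 else complex_of_real \<epsilon>)"
  have "tensor_op (\<lambda>i. censor \<epsilon> (ketbra (a i) (b i))) $ x $ y = w * ketbra a b $ x $ y"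
    for a b :: "'n \<Rightarrow> 'd"
    \<comment> \<open>With the right-hand \<open>ketbra a b\<close> written as a product operator,
      both sides are products over the systems and agree factor by factor.\<close>
    unfolding tensor_op_ketbra[symmetric, of a b]
    by (simp add: tensor_op_def censor_nth prod.distrib w_def)
  then have "tensor_power (censor \<epsilon>) \<rho> $ x $ y
      = (\<Sum>a\<in>UNIV. \<Sum>b\<in>UNIV. \<rho> $ a $ b * (w * ketbra a b $ x $ y))"
    by (simp add: tensor_power_def cscale_def)
  also have "\<dots> = (\<Sum>a\<in>UNIV. \<Sum>b\<in>UNIV. if b = y then if a = x then w * \<rho> $ x $ y else 0 else 0)"
    by (intro sum.cong refl) (auto simp: ketbra_def)
  also have "\<dots> = w * \<rho> $ x $ y"
    by simp
  finally show ?thesis by (simp add: w_def)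
qed

lemma l1_coherence_censor:
  fixes \<rho> :: "('n::finite \<Rightarrow> 'd::finite) op"
  assumes "0 \<le> \<epsilon>" "\<epsilon> \<le> 1"
  shows "l1_coherence (tensor_power (censor \<epsilon>) \<rho>) \<le> \<epsilon> * l1_coherence \<rho>"
proof -
  have "cmod (tensor_power (censor \<epsilon>) \<rho> $ x $ y) \<le> \<epsilon> * cmod (\<rho> $ x $ y)" if "x \<noteq> y" for x y
  proof -
    obtain j where j: "x j \<noteq> y j" using \<open>x \<noteq> y\<close> by auto
    define v where "v i = (if x i = y i then 1 else \<epsilon>)" for i
    have v: "0 \<le> v i" "v i \<le> 1" for i
      using assms by (auto simp: v_def)
    \<comment> \<open>One system where the labels differ supplies the factor \<epsilon>; all other
      factors are at most 1.\<close>
    have "(\<Prod>i\<in>UNIV. v i) = v j * (\<Prod>i\<in>UNIV - {j}. v i)"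
      by (simp add: prod.remove)
    also have "\<dots> \<le> \<epsilon> * 1"
      using j v assms by (intro mult_mono prod_le_1 prod_nonneg) (auto simp: v_def)
    finally have "(\<Prod>i\<in>UNIV. v i) \<le> \<epsilon>" by simp
    moreover have "cmod (\<Prod>i\<in>UNIV. if x i = y i then 1 else of_real \<epsilon>) = (\<Prod>i\<in>UNIV. v i)"
      unfolding prod_norm[symmetric] v_def using assms by (intro prod.cong) auto
    ultimately show ?thesis
      by (simp add: tensor_power_censor_nth norm_mult mult_right_mono)
  qed
  then show ?thesis
    unfolding l1_coherence_def sum_distrib_left by (intro sum_mono) simp
qed

section \<open>From vanishing coherence norm to incoherent states\<close>

lemma l1_coherence_nonneg: "0 \<le> l1_coherence A"
  unfolding l1_coherence_def by (intro sum_nonneg) simp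

lemma l1_coherence_le_0_imp_diagonal:
  assumes "l1_coherence A \<le> 0" "x \<noteq> y"
  shows "A $ x $ y = 0"
proof -
  have "l1_coherence A = 0"
    using assms l1_coherence_nonneg[of A] by simp
  then have "(\<Sum>y\<in>UNIV. if x = y then 0 else cmod (A $ x $ y)) = 0"
    unfolding l1_coherence_def by (subst (asm) sum_nonneg_eq_0_iff) (auto intro!: sum_nonneg)
  then have "(if x = y then 0 else cmod (A $ x $ y)) = 0"
    by (subst (asm) sum_nonneg_eq_0_iff) auto
  then show ?thesis using assms by simp
qed

text \<open>The sign comes from testing positivity on the basis vector \<open>axis a 1\<close>, the
  reality from hermiticity.\<close>

lemma positive_op_diag:
  assumes "positive_op A"
  shows "0 \<le> Re (A $ a $ a)" "Im (A $ a $ a) = 0"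
proof -
  have "(\<Sum>i\<in>UNIV. cnj (axis a 1 $ i) * (A *v axis a 1) $ i)
      = (\<Sum>i\<in>UNIV. if i = a then A $ a $ a else 0)"
    by (intro sum.cong refl)
      (auto simp: axis_def matrix_vector_mult_def if_distrib cong: if_cong)
  then have "(\<Sum>i\<in>UNIV. cnj (axis a 1 $ i) * (A *v axis a 1) $ i) = A $ a $ a"
    by simp
  then show "0 \<le> Re (A $ a $ a)"
    using assms unfolding positive_op_def by metis
  have "dagger A $ a $ a = A $ a $ a"
    using assms by (simp add: positive_op_def)
  then show "Im (A $ a $ a) = 0"
    by (simp add: dagger_def complex_eq_iff)
qed

text \<open>The diagonal itself is the required distribution: positivity makes it real and
  nonnegative, and unit trace normalises it.\<close>

lemma diagonal_density_operator_incoherent: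
  assumes "density_operator \<rho>" and diag: "\<And>x y. x \<noteq> y \<Longrightarrow> \<rho> $ x $ y = 0"
  shows "\<rho> \<in> incoherent_states"
proof -
  have pos: "positive_op \<rho>" and tr: "trace \<rho> = 1"
    using assms by (auto simp: density_operator_def)
  define p where "p a = Re (\<rho> $ a $ a)" for a
  have p: "\<rho> $ a $ a = of_real (p a)" for a
    using positive_op_diag[OF pos] by (simp add: p_def complex_eq_iff)
  have "(\<Sum>a\<in>UNIV. p a) = Re (trace \<rho>)"
    by (simp add: trace_def p_def)
  then have sum1: "(\<Sum>a\<in>UNIV. p a) = 1"
    by (simp add: tr)
  have "\<rho> $ x $ y = (\<Sum>a\<in>UNIV. p a *\<^sub>R ketbra a a) $ x $ y" for x y
  proof -
    have "(\<Sum>a\<in>UNIV. p a *\<^sub>R ketbra a a) $ x $ y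
        = (\<Sum>a\<in>UNIV. if a = x then if x = y then of_real (p x) else 0 else 0)"
      unfolding sum_component by (intro sum.cong) (auto simp: ketbra_def scaleR_conv_of_real[where 'a = complex])
    then show ?thesis by (simp add: p diag)
  qed
  then have "\<rho> = (\<Sum>a\<in>UNIV. p a *\<^sub>R ketbra a a)"
    by (simp add: vec_eq_iff)
  moreover have "0 \<le> p a" for a
    using positive_op_diag(1)[OF pos] by (simp add: p_def)
  ultimately show ?thesis
    using sum1 by (auto simp: incoherent_states_def)
qed

theorem theorem3:
  fixes \<epsilon> :: real and \<rho> :: "('n::finite \<Rightarrow> 'd::finite) op"
  assumes "0 \<le> \<epsilon>" and "\<epsilon> < 1"
    and "density_operator \<rho>"
    and "\<rho> \<notin> incoherent_states"
  shows "\<not> (\<exists>\<Lambda> \<in> incoherent_operations. \<Lambda> (tensor_power (censor \<epsilon>) \<rho>) = \<rho>)"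
proof
  assume "\<exists>\<Lambda> \<in> incoherent_operations. \<Lambda> (tensor_power (censor \<epsilon>) \<rho>) = \<rho>"
  then have "l1_coherence \<rho> \<le> l1_coherence (tensor_power (censor \<epsilon>) \<rho>)"
    using l1_coherence_incoherent_operation by metis
  also have "\<dots> \<le> \<epsilon> * l1_coherence \<rho>"
    using assms by (intro l1_coherence_censor) auto
  finally have "(1 - \<epsilon>) * l1_coherence \<rho> \<le> 0"
    by (simp add: algebra_simps)
  \<comment> \<open>Here strictness of \<epsilon> < 1 enters: the factor
    \<open>1 - \<epsilon>\<close> is positive and can be cancelled.\<close>
  then have "l1_coherence \<rho> \<le> 0"
    using \<open>\<epsilon> < 1\<close> by (simp add: mult_le_0_iff)
  then have "\<rho> \<in> incoherent_states"
    using assms l1_coherence_le_0_imp_diagonal diagonal_density_operator_incoherent by blast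
  then show False using assms by simp
qed

end
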